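(* Let $X$ be a set and let $\mathscr{A}$ and $\mathscr{B}$ be collections of families of subsets of $X$. If $X$ satisfies the principle $\mathbf{CS}_{fin}(\mathscr{A},\mathscr{B})$, then $X$ satisfies the principle $\mathbf{S}_{fin}^*(\mathscr{A},\mathscr{R}_{\mathscr{B}}^+)$.
   Context: For a set $Y$, $[Y]^{<\omega}$ is the collection of all finite subsets of $Y$ (including $\emptyset$; $\bigcup\emptyset=\emptyset$). For $A\subseteq X$ and a family $\mathcal{U}$ of subsets of $X$, $St(A,\mathcal{U})=\bigcup\{U\in\mathcal{U}:U\cap A\neq\emptyset\}$. For families $\mathcal{A},\mathcal{B}$ of sets, $\mathcal{A}$ refines $\mathcal{B}$, written $\mathcal{A}\prec\mathcal{B}$, if for every $A\in\mathcal{A}$ there is $B\in\mathcal{B}$ with $A\subseteq B$. For a collection $\mathscr{B}$ of families of subsets of $X$, $\mathscr{R}_{\mathscr{B}}^+=\{\mathcal{R}:\text{there exists }\mathcal{B}\in\mathscr{B}\text{ such that }\mathcal{B}\prec\mathcal{R}\}$, where $\mathcal{R}$ ranges over families of subsets of $X$. For collections $\mathscr{A},\mathscr{B}$ of families of subsets of $X$: $\mathbf{S}^*_{fin}(\mathscr{A},\mathscr{B})$: for any sequence $\{\mathcal{A}_n:n\in\omega\}$ of elements of $\mathscr{A}$ there is a sequence $\{\mathcal{B}_n:n\in\omega\}$ such that $\mathcal{B}_n$ is a finite subset of $\mathcal{A}_n$ for each $n\in\omega$, and $\bigcup_{n\in\omega}\{St(B,\mathcal{A}_n):B\in\mathcal{B}_n\}\in\mathscr{B}$.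 $\mathbf{CS}_{fin}(\mathscr{A},\mathscr{B})$: for any sequence $\{\mathcal{U}_n:n\in\omega\}$ of elements of $\mathscr{A}$ there is a sequence $\{\mathcal{U}_n^f:n\in\omega\}$ such that, for each $n\in\omega$, $\mathcal{U}_n^f=\{U_n^1,\dots,U_n^{k_n}\}$ is a finite subset of $\mathcal{U}_n$, and $\bigcup\{\mathcal{V}_n^i:n\in\omega\text{ and }i\in\{1,\dots,k_n\}\}\in\mathscr{B}$, where $\mathcal{V}_n^i=\{\bigcup\mathcal{V}:\mathcal{V}\in[\mathcal{U}_n]^{<\omega}\text{ and }U_n^i\cap V\neq\emptyset\text{ for each }V\in\mathcal{V}\}$. *)

theory Defs
  imports Main
begin

definition star :: "'a set \<Rightarrow> 'a set set \<Rightarrow> 'a set" where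
  "star A \<U> = \<Union>{U \<in> \<U>. U \<inter> A \<noteq> {}}"

definition refines :: "'a set set \<Rightarrow> 'a set set \<Rightarrow> bool" where
  "refines \<A> \<B> \<longleftrightarrow> (\<forall>A\<in>\<A>. \<exists>B\<in>\<B>. A \<subseteq> B)"

definition refined_plus :: "'a set \<Rightarrow> 'a set set set \<Rightarrow> 'a set set set" where
  "refined_plus X \<BB> = {\<R>. \<R> \<subseteq> Pow X \<and> (\<exists>\<B>\<in>\<BB>. refines \<B> \<R>)}"

(* The ground set X enters the two principles only through the collections
   of families of subsets of X, so it is not a separate argument. *)

definition S_star_fin :: "'a set set set \<Rightarrow> 'a set set set \<Rightarrow> bool" where
  "S_star_fin \<AA> \<BB> \<longleftrightarrow>
    (\<forall>\<A> :: nat \<Rightarrow> 'a set set. (\<forall>n. \<A> n \<in> \<AA>) \<longrightarrow>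
      (\<exists>\<B> :: nat \<Rightarrow> 'a set set.
        (\<forall>n. finite (\<B> n) \<and> \<B> n \<subseteq> \<A> n) \<and>
        (\<Union>n. {star B (\<A> n) | B. B \<in> \<B> n}) \<in> \<BB>))"

definition finite_unions_meeting :: "'a set \<Rightarrow> 'a set set \<Rightarrow> 'a set set" where
  "finite_unions_meeting W \<U> =
    {\<Union>\<V> | \<V>. finite \<V> \<and> \<V> \<subseteq> \<U> \<and> (\<forall>V\<in>\<V>. W \<inter> V \<noteq> {})}"

(* The enumeration U_n^1, ..., U_n^{k_n} of the finite set F n is replaced by
   indexing over the elements of F n; F n may be empty (k_n = 0). *)

definition CS_fin :: "'a set set set \<Rightarrow> 'a set set set \<Rightarrow> bool" where
  "CS_fin \<AA> \<BB> \<longleftrightarrow>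
    (\<forall>\<U> :: nat \<Rightarrow> 'a set set. (\<forall>n. \<U> n \<in> \<AA>) \<longrightarrow>
      (\<exists>F :: nat \<Rightarrow> 'a set set.
        (\<forall>n. finite (F n) \<and> F n \<subseteq> \<U> n) \<and>
        (\<Union>n. \<Union>W\<in>F n. finite_unions_meeting W (\<U> n)) \<in> \<BB>))"

end

theory Submission
  imports Defs
begin

text \<open>The finite sets selected by \<open>CS_fin\<close> also witness \<open>S_star_fin\<close>: a union of members of
  \<open>\<U>\<close> that all meet \<open>W\<close> is contained in the star of \<open>W\<close>, so the family of finite unions,
  which lies in \<open>\<BB>\<close>, refines the family of stars.\<close>

lemma finite_unions_meeting_subset_star:
  assumes "A \<in> finite_unions_meeting W \<U>"
  shows "A \<subseteq> star W \<U>"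
  using assms unfolding finite_unions_meeting_def star_def by blast

lemma star_subset:
  assumes "\<U> \<subseteq> Pow X"
  shows "star W \<U> \<subseteq> X"
  using assms unfolding star_def by blast

theorem theorem3p5:
  fixes X :: "'a set" and \<AA> \<BB> :: "'a set set set"
  assumes "\<forall>\<A>\<in>\<AA>. \<A> \<subseteq> Pow X"
    and "\<forall>\<B>\<in>\<BB>. \<B> \<subseteq> Pow X"
    and "CS_fin \<AA> \<BB>"
  shows "S_star_fin \<AA> (refined_plus X \<BB>)"
  unfolding S_star_fin_def
proof (intro allI impI)
  fix \<U> :: "nat \<Rightarrow> 'a set set"
  assume \<U>: "\<forall>n. \<U> n \<in> \<AA>"
  obtain F where F: "\<forall>n. finite (F n) \<and> F n \<subseteq> \<U> n"
    and in_\<BB>: "(\<Union>n. \<Union>W\<in>F n. finite_unions_meeting W (\<U> n)) \<in> \<BB>"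
    using assms(3)[unfolded CS_fin_def, rule_format, of \<U>] \<U> by auto
  let ?unions = "\<Union>n. \<Union>W\<in>F n. finite_unions_meeting W (\<U> n)"
  let ?stars = "\<Union>n. {star W (\<U> n) | W. W \<in> F n}"
  have "star W (\<U> n) \<subseteq> X" for W n
    using \<U> assms(1) by (simp add: star_subset)
  then have "?stars \<subseteq> Pow X"
    by blast
  moreover have "refines ?unions ?stars"
    unfolding refines_def
  proof
    fix A assume "A \<in> ?unions"
    then obtain n W where "W \<in> F n" "A \<in> finite_unions_meeting W (\<U> n)"
      by blast
    then show "\<exists>B\<in>?stars. A \<subseteq> B"
      using finite_unions_meeting_subset_star by blast
  qed
  ultimately have "?stars \<in> refined_plus X \<BB>"
    using in_\<BB> unfolding refined_plus_def by (intro CollectI conjI bexI)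
  with F show "\<exists>\<B>. (\<forall>n. finite (\<B> n) \<and> \<B> n \<subseteq> \<U> n) \<and>
      (\<Union>n. {star B (\<U> n) | B. B \<in> \<B> n}) \<in> refined_plus X \<BB>"
    by (intro exI[of _ F] conjI)
qed

end
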